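(* Let $M=(\mathcal{S},\mathcal{I})$ be a matroid of rank $r(M)\ge1$. For any $\epsilon>0$, the circuit swap neighborhood for the minimum (expected) cost base problem on $M$ admits $(\beta,\gamma)$-improving moves with $\gamma=1+\epsilon$ and $\beta=1-\epsilon/(2r(M))$; that is, for every base $B$ with $\mathrm{Cost}(B)>(1+\epsilon)\,\mathrm{OPT}$ there is $B'\in\mathcal{N}(B)$ with $\mathrm{Cost}(B')\le\left(1-\frac{\epsilon}{2r(M)}\right)\mathrm{Cost}(B)$.
   Context: $\mathcal{B}$ denotes the set of bases (maximal independent sets) of $M$; $r(M)$ is the cardinality of any base. Element costs $Z=(Z_s)_{s\in\mathcal{S}}$ are nonnegative random variables with joint distribution $\mathcal{D}$ and finite means; $\mathrm{Cost}(B)=\mathbb{E}_{Z\sim\mathcal{D}}\left[\sum_{s\in B}Z_s\right]$ and $\mathrm{OPT}=\min_{B\in\mathcal{B}}\mathrm{Cost}(B)$. For a base $B$ and $s\in\mathcal{S}\setminus B$, let $C(s,B)$ be the unique circuit (minimal dependent set) contained in $B\cup\{s\}$. The circuit swap neighborhood is $$\mathcal{N}(B)=\{B'\in\mathcal{B}: B'=(B\cup\{s\})\setminus\{t\}\text{ for some }s\in\mathcal{S}\setminus B,\ t\in C(s,B)\}.$$ In general, a problem with feasible set $\mathcal{X}$, neighborhood map $\mathcal{N}$ and expected cost $\mathrm{Cost}$ admits $(\beta,\gamma)$-improving moves if for every $x\in\mathcal{X}$ with $\mathrm{Cost}(x)>\gamma\,\mathrm{OPT}$ there is $x'\in\mathcal{N}(x)$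 with $\mathrm{Cost}(x')\le\beta\,\mathrm{Cost}(x)$.
   Formalization: The claim is proved for 0 < ε ≤ 1 rather than for any ε > 0; for every ε > 1 it is false, e.g. rank 1 with two parallel elements of costs 1 and 1/4 and ε = 2, where β = 0 but no base has cost 0. *)

theory Defs
  imports "HOL-Probability.Probability"
begin

section \<open>Matroids\<close>

locale matroid =
  fixes S :: "'s set" and \<I> :: "'s set set"
  assumes finite_ground: "finite S"
    and indep_subset_ground: "A \<in> \<I> \<Longrightarrow> A \<subseteq> S"
    and indep_empty: "{} \<in> \<I>"
    and indep_subset: "A \<in> \<I> \<Longrightarrow> A' \<subseteq> A \<Longrightarrow> A' \<in> \<I>"
    and augmentation: "A \<in> \<I> \<Longrightarrow> A' \<in> \<I> \<Longrightarrow> card A < card A' \<Longrightarrow>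
      \<exists>x\<in>A' - A. insert x A \<in> \<I>"

definition bases :: "'s set set \<Rightarrow> 's set set" where
  "bases \<I> = {B \<in> \<I>. \<forall>A\<in>\<I>. B \<subseteq> A \<longrightarrow> A = B}"

definition circuits :: "'s set \<Rightarrow> 's set set \<Rightarrow> 's set set" where
  "circuits S \<I> = {C. C \<subseteq> S \<and> C \<notin> \<I> \<and> (\<forall>A. A \<subset> C \<longrightarrow> A \<in> \<I>)}"

text \<open>The choice of the base is immaterial, see \<open>card_base\<close> below.\<close>

definition matroid_rank :: "'s set set \<Rightarrow> nat" where
  "matroid_rank \<I> = card (SOME B. B \<in> bases \<I>)"

text \<open>Well defined for a base \<open>B\<close> and \<open>s \<in> S - B\<close>, see \<open>ex1_circuit\<close> below.\<close>

definition fundamental_circuit :: "'s set \<Rightarrow> 's set set \<Rightarrow> 's \<Rightarrow> 's set \<Rightarrow> 's set" where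
  "fundamental_circuit S \<I> s B = (THE C. C \<in> circuits S \<I> \<and> C \<subseteq> B \<union> {s})"

definition circuit_swaps :: "'s set \<Rightarrow> 's set set \<Rightarrow> 's set \<Rightarrow> 's set set" where
  "circuit_swaps S \<I> B =
     {B' \<in> bases \<I>. \<exists>s\<in>S - B. \<exists>t\<in>fundamental_circuit S \<I> s B. B' = (B \<union> {s}) - {t}}"

context matroid
begin

lemma finite_indep: "A \<in> \<I> \<Longrightarrow> finite A"
  using finite_ground indep_subset_ground finite_subset by blast

lemma finite_bases: "finite (bases \<I>)"
proof (rule finite_subset)
  show "bases \<I> \<subseteq> Pow S"
    using indep_subset_ground by (auto simp: bases_def)
qed (use finite_ground in simp)

lemma card_indep_le_base:
  assumes "A \<in> \<I>" "B \<in> bases \<I>"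
  shows "card A \<le> card B"
proof (rule ccontr)
  assume "\<not> card A \<le> card B"
  then obtain x where "x \<in> A - B" "insert x B \<in> \<I>"
    using augmentation[of B A] assms by (auto simp: bases_def)
  then show False
    using assms(2) by (auto simp: bases_def)
qed

lemma indep_extends:
  assumes "A \<in> \<I>" "B \<in> \<I>" "card A \<le> card B"
  shows "\<exists>A'\<in>\<I>. A \<subseteq> A' \<and> A' \<subseteq> A \<union> B \<and> card A' = card B"
  using assms
proof (induction "card B - card A" arbitrary: A)
  case 0
  then show ?case by auto
next
  case (Suc n)
  then have "card A < card B" by linarith
  then obtain x where x: "x \<in> B - A" "insert x A \<in> \<I>"
    using augmentation[of A B] Suc.prems by auto
  have c: "card (insert x A) = Suc (card A)"
    using x Suc.prems finite_indep by simp
  have "\<exists>A'\<in>\<I>. insert x A \<subseteq> A' \<and> A' \<subseteq> insert x A \<union> B \<and> card A' = card B"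
    using Suc.hyps(2) Suc.prems x c by (intro Suc.hyps(1)) auto
  then show ?case
    using x by auto
qed

lemma bases_nonempty: "bases \<I> \<noteq> {}"
proof -
  have "finite \<I>"
    using finite_ground indep_subset_ground by (meson Pow_iff finite_Pow_iff finite_subset subsetI)
  then obtain B where "B \<in> \<I>" "\<forall>A\<in>\<I>. B \<subseteq> A \<longrightarrow> A = B"
    using finite_has_maximal[of \<I>] indep_empty by auto
  then show ?thesis by (auto simp: bases_def)
qed

lemma card_base:
  assumes "B \<in> bases \<I>"
  shows "card B = matroid_rank \<I>"
proof -
  define B' where "B' = (SOME B. B \<in> bases \<I>)"
  have "B' \<in> bases \<I>"
    unfolding B'_def using assms by (rule someI)
  then show ?thesis
    using assms card_indep_le_base[of B B'] card_indep_le_base[of B' B]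
    unfolding matroid_rank_def B'_def[symmetric] by (auto simp: bases_def)
qed

lemma ex1_circuit:
  assumes B: "B \<in> bases \<I>" and s: "s \<in> S - B"
  shows "\<exists>!C. C \<in> circuits S \<I> \<and> C \<subseteq> B \<union> {s}"
proof -
  have BI: "B \<in> \<I>" and dep: "B \<union> {s} \<notin> \<I>"
    using B s by (auto simp: bases_def)
  have fin: "finite (B \<union> {s})" and sub: "B \<union> {s} \<subseteq> S"
    using finite_indep[OF BI] indep_subset_ground[OF BI] s by auto
  let ?D = "{C. C \<subseteq> B \<union> {s} \<and> C \<notin> \<I>}"
  have "finite ?D"
    by (rule finite_subset[of _ "Pow (B \<union> {s})"]) (use fin in auto)
  moreover have "?D \<noteq> {}"
    using dep by auto
  ultimately obtain C where C: "C \<in> ?D" "\<forall>A\<in>?D. A \<subseteq> C \<longrightarrow> C = A"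
    using finite_has_minimal[of ?D] by auto
  have ex: "C \<in> circuits S \<I> \<and> C \<subseteq> B \<union> {s}"
    using C sub unfolding circuits_def by blast
  have uniq: "C1 \<subseteq> C2"
    if C1: "C1 \<in> circuits S \<I>" "C1 \<subseteq> B \<union> {s}" and C2: "C2 \<in> circuits S \<I>" "C2 \<subseteq> B \<union> {s}"
    for C1 C2
  proof
    fix e assume e: "e \<in> C1"
    show "e \<in> C2"
    proof (rule ccontr)
      assume e2: "e \<notin> C2"
      have I: "C1 - {e} \<in> \<I>"
        using C1(1) e by (auto simp: circuits_def)
      obtain A where A: "A \<in> \<I>" "C1 - {e} \<subseteq> A" "A \<subseteq> (C1 - {e}) \<union> B" "card A = card B"
        using indep_extends[OF I BI card_indep_le_base[OF I B]] by auto
      have AB: "A \<subseteq> B \<union> {s}"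
        using A(3) C1(2) by auto
      have "card (B \<union> {s} - A) = 1"
        using AB A(4) fin s finite_indep[OF BI] finite_indep[OF A(1)]
        by (subst card_Diff_subset) auto
      then obtain f where f: "B \<union> {s} - A = {f}"
        by (auto simp: card_1_singleton_iff)
      have "\<not> C1 \<subseteq> A"
        using indep_subset[OF A(1)] C1(1) by (auto simp: circuits_def)
      then have "e \<notin> A"
        using A(2) by blast
      then have "f = e"
        using f e C1(2) by auto
      then have "C2 \<subseteq> A"
        using f C2(2) e2 by fastforce
      then show False
        using indep_subset[OF A(1)] C2(1) by (auto simp: circuits_def)
    qed
  qed
  show ?thesis
    using ex uniq by (intro ex1I[of _ C]) blast+
qed

end

section \<open>Random element costs\<close>

text \<open>\<open>D\<close> is the joint distribution of the cost vector \<open>Z = (Z\<^sub>s)\<close>, a probability measure on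
  the product space over the ground set; a sample \<open>z\<close> assigns cost \<open>z s\<close> to \<open>s \<in> S\<close>.\<close>

locale stochastic_base_problem = matroid S \<I> + prob_space D
  for S :: "'s set" and \<I> :: "'s set set" and D :: "('s \<Rightarrow> real) measure" +
  assumes sets_D: "sets D = sets (Pi\<^sub>M S (\<lambda>_. borel))"
    and cost_nonneg: "s \<in> S \<Longrightarrow> AE z in D. 0 \<le> z s"
    and finite_mean: "s \<in> S \<Longrightarrow> integrable D (\<lambda>z. z s)"

definition Cost :: "('s \<Rightarrow> real) measure \<Rightarrow> 's set \<Rightarrow> real" where
  "Cost D B = (\<integral>z. (\<Sum>s\<in>B. z s) \<partial>D)"

section \<open>Improving moves\<close>

text \<open>\<open>Min\<close> is meaningful for finite nonempty \<open>X\<close>; for \<open>X = bases \<I>\<close> see \<open>finite_bases\<close> and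
  \<open>bases_nonempty\<close>.\<close>

definition OPT :: "'x set \<Rightarrow> ('x \<Rightarrow> real) \<Rightarrow> real" where
  "OPT X c = Min (c ` X)"

definition admits_improving_moves ::
    "'x set \<Rightarrow> ('x \<Rightarrow> 'x set) \<Rightarrow> ('x \<Rightarrow> real) \<Rightarrow> real \<Rightarrow> real \<Rightarrow> bool" where
  "admits_improving_moves X N c \<beta> \<gamma> \<longleftrightarrow>
     (\<forall>x\<in>X. c x > \<gamma> * OPT X c \<longrightarrow> (\<exists>x'\<in>N x. c x' \<le> \<beta> * c x))"

text \<open>With \<open>\<gamma> = 1 + \<epsilon>\<close> and \<open>\<beta> = 1 - \<epsilon> / (2 * r)\<close> the improving move property of circuit swaps
  needs \<open>\<epsilon> \<le> 1\<close>. For \<open>\<epsilon> > 1\<close> it fails: take two parallel elements (rank 1) with deterministic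
  costs \<open>1\<close> and \<open>q\<close>, where \<open>max 0 (1 - \<epsilon> / 2) < q < 1 / (1 + \<epsilon>)\<close>. The base of cost \<open>1\<close> exceeds
  \<open>(1 + \<epsilon>) * q\<close>, but no base costs at most \<open>1 - \<epsilon> / 2\<close>.\<close>

end

(* By symmetric exchange, the optimal base can be moved to B one element at a time, each step
   pairing a removed t in B with an added y such that B - t + y is a base. Hence the cost gap
   Cost B - OPT is at most r times the largest gain of a single swap. If no swap gained
   \<epsilon> / (2 r) * Cost B, then OPT >= (1 - \<epsilon>/2) * Cost B, and (1 + \<epsilon>) * (1 - \<epsilon>/2) >= 1 for
   \<epsilon> <= 1 contradicts Cost B > (1 + \<epsilon>) * OPT. *)
theory Submission
  imports Defs
begin

context matroid
begin

lemma base_if_indep_card: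
  assumes "A \<in> \<I>" "B \<in> bases \<I>" "card A = card B"
  shows "A \<in> bases \<I>"
proof -
  have "A' = A" if A': "A' \<in> \<I>" "A \<subseteq> A'" for A'
    using card_seteq[OF finite_indep[OF A'(1)] A'(2)] card_indep_le_base[OF A'(1) assms(2)]
      assms(3) by simp
  then show ?thesis
    using assms(1) by (auto simp: bases_def)
qed

lemma fundamental_circuit:
  assumes "B \<in> bases \<I>" "s \<in> S - B"
  shows "fundamental_circuit S \<I> s B \<in> circuits S \<I>"
    and "fundamental_circuit S \<I> s B \<subseteq> insert s B"
  using theI'[OF ex1_circuit[OF assms]] by (auto simp: fundamental_circuit_def)

text \<open>An independent set contains no circuit, so the circuit inside \<open>insert y B\<close>
  must use the one element \<open>t\<close> that the new base omits. Hence every single-element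
  exchange that yields a base is a circuit swap.\<close>

lemma circuit_swapsI:
  assumes B: "B \<in> bases \<I>" and y: "y \<in> S - B" and t: "t \<in> B"
    and swap: "insert y (B - {t}) \<in> bases \<I>"
  shows "insert y (B - {t}) \<in> circuit_swaps S \<I> B"
proof -
  have "\<not> fundamental_circuit S \<I> y B \<subseteq> insert y (B - {t})"
    using fundamental_circuit(1)[OF B y] swap indep_subset
    by (auto simp: circuits_def bases_def)
  then have "t \<in> fundamental_circuit S \<I> y B"
    using fundamental_circuit(2)[OF B y] by blast
  moreover have "insert y (B - {t}) = (B \<union> {y}) - {t}"
    using y t by auto
  ultimately show ?thesis
    using swap y unfolding circuit_swaps_def by blast
qed

text \<open>Let \<open>C\<close> be the circuit that \<open>t\<close> closes in \<open>B'\<close>.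
  Any element of \<open>C - {t}\<close> can leave \<open>B'\<close> in favour of \<open>t\<close>,
  so it suffices to find one outside \<open>B\<close> that can replace \<open>t\<close> in
  \<open>B\<close>.\<close>

lemma symmetric_exchange:
  assumes B: "B \<in> bases \<I>" and B': "B' \<in> bases \<I>" and t: "t \<in> B - B'"
  shows "\<exists>y\<in>B' - B. insert y (B - {t}) \<in> bases \<I> \<and> insert t (B' - {y}) \<in> bases \<I>"
proof -
  define C where "C = fundamental_circuit S \<I> t B'"
  have BI: "B \<in> \<I>" "B' \<in> \<I>"
    using B B' by (auto simp: bases_def)
  have fin: "finite B" "finite B'"
    using BI finite_indep by auto
  have tS: "t \<in> S - B'"
    using t indep_subset_ground[OF BI(1)] by auto
  have C: "C \<notin> \<I>" "C \<subseteq> insert t B'" "\<And>e. e \<in> C \<Longrightarrow> C - {e} \<in> \<I>"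
    using fundamental_circuit[OF B' tS] unfolding C_def circuits_def by auto
  have tC: "t \<in> C"
    using C(1,2) indep_subset[OF BI(2)] by auto
  have cards: "card B = card B'"
    using card_base B B' by simp
  \<comment> \<open>Extending \<open>C - {t}\<close> within \<open>B\<close> gives an independent
    set of full size. It avoids \<open>t\<close>, since otherwise it would contain
    \<open>C\<close>.\<close>
  obtain A where A: "A \<in> \<I>" "C - {t} \<subseteq> A" "A \<subseteq> (C - {t}) \<union> B" "card A = card B"
    using indep_extends[OF C(3)[OF tC] BI(1) card_indep_le_base[OF C(3)[OF tC] B]] by auto
  have "t \<notin> A"
    using A(1,2) C(1) indep_subset by blast
  moreover have BtI: "B - {t} \<in> \<I>"
    using indep_subset[OF BI(1)] by auto
  moreover have "card (B - {t}) < card A"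
    unfolding A(4) using t fin by (intro card_Diff1_less) auto
  \<comment> \<open>Augmenting \<open>B - {t}\<close> from \<open>A\<close> adds an element other
    than \<open>t\<close> and outside \<open>B\<close>, and all such elements of \<open>A\<close>
    come from \<open>C\<close>.\<close>
  ultimately obtain y where y: "y \<in> C" "y \<noteq> t" "y \<notin> B" "insert y (B - {t}) \<in> \<I>"
    using augmentation[OF BtI A(1)] A(3) by blast
  have yB': "y \<in> B'"
    using y C(2) by auto
  have "card (insert y (B - {t})) = card B"
    using y t fin card_Suc_Diff1[of B t] by simp
  then have base1: "insert y (B - {t}) \<in> bases \<I>"
    using base_if_indep_card[OF y(4) B] by simp
  have Cy: "C - {y} \<in> \<I>"
    using C(3) y by simp
  \<comment> \<open>The extension of \<open>C - {y}\<close> within \<open>B'\<close> omits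
    \<open>y\<close>, so it lies in \<open>insert t (B' - {y})\<close>. Equal cardinality forces
    equality and shows that the latter is independent.\<close>
  obtain A' where A': "A' \<in> \<I>" "C - {y} \<subseteq> A'" "A' \<subseteq> (C - {y}) \<union> B'" "card A' = card B'"
    using indep_extends[OF Cy BI(2) card_indep_le_base[OF Cy B']] by auto
  have "y \<notin> A'"
    using A'(1,2) C(1) indep_subset by blast
  then have "A' \<subseteq> insert t (B' - {y})"
    using A'(3) C(2) by auto
  moreover have "card (insert t (B' - {y})) = card B'"
    using t yB' fin card_Suc_Diff1[of B' y] by simp
  ultimately have "A' = insert t (B' - {y})"
    using fin A'(4) by (intro card_subset_eq) auto
  then have "insert t (B' - {y}) \<in> bases \<I>"
    using base_if_indep_card[OF A'(1) B' A'(4)] by simp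
  with base1 y(3) yB' show ?thesis
    by auto
qed

text \<open>Induction on the distance from \<open>B'\<close> to \<open>B\<close>, with
  \<open>B\<close> fixed. Symmetric exchange moves \<open>B'\<close> one element closer while
  pairing that move with a swap of \<open>B\<close> itself, so each step changes the weight by an
  amount that \<open>gain\<close> controls.\<close>

lemma base_weight_diff_le:
  fixes w :: "'s \<Rightarrow> real"
  assumes B: "B \<in> bases \<I>" and B': "B' \<in> bases \<I>"
    and gain: "\<And>t y. t \<in> B \<Longrightarrow> y \<in> S - B \<Longrightarrow> insert y (B - {t}) \<in> bases \<I> \<Longrightarrow> w t - w y \<le> \<delta>"
  shows "sum w B - sum w B' \<le> real (card (B - B')) * \<delta>"
  using B'
proof (induction "card (B - B')" arbitrary: B')
  case 0
  have "finite B"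
    using B finite_indep by (auto simp: bases_def)
  then have "B \<subseteq> B'"
    using 0 by auto
  then have "B' = B"
    using B 0 by (auto simp: bases_def)
  then show ?case by simp
next
  case (Suc n)
  have fin: "finite B" "finite B'"
    using B Suc.prems finite_indep by (auto simp: bases_def)
  obtain t where t: "t \<in> B - B'"
    using Suc.hyps(2) by (metis card.empty ex_in_conv nat.distinct(1))
  obtain y where y: "y \<in> B' - B" "insert y (B - {t}) \<in> bases \<I>" "insert t (B' - {y}) \<in> bases \<I>"
    using symmetric_exchange[OF B Suc.prems t] by auto
  let ?B = "insert t (B' - {y})"
  have "B - ?B = (B - B') - {t}"
    using y t by auto
  then have n: "card (B - ?B) = n"
    using Suc.hyps(2) t fin by simp
  have "sum w B - sum w ?B \<le> real n * \<delta>"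
    using Suc.hyps(1)[OF _ y(3)] n by simp
  moreover have "sum w ?B = sum w B' - w y + w t"
    using t y fin by (simp add: sum_diff1)
  moreover have "y \<in> S - B"
    using y indep_subset_ground Suc.prems by (auto simp: bases_def)
  then have "w t - w y \<le> \<delta>"
    using gain y(2) t by auto
  ultimately show ?case
    by (simp add: Suc.hyps(2)[symmetric] algebra_simps)
qed

end

text \<open>Linearity of expectation reduces the stochastic problem to a deterministic one whose
  weights are the means.\<close>

lemma (in stochastic_base_problem) Cost_eq_sum:
  assumes "B \<subseteq> S"
  shows "Cost D B = (\<Sum>s\<in>B. \<integral>z. z s \<partial>D)"
  unfolding Cost_def using assms finite_mean by (intro Bochner_Integration.integral_sum) auto

theorem lemma4p7:
  fixes S :: "'s set" and \<I> :: "'s set set" and D :: "('s \<Rightarrow> real) measure" and \<epsilon> :: real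
  assumes "stochastic_base_problem S \<I> D"
    and "matroid_rank \<I> \<ge> 1"
    and "0 < \<epsilon>" and "\<epsilon> \<le> 1"
  shows "admits_improving_moves (bases \<I>) (circuit_swaps S \<I>) (Cost D)
           (1 - \<epsilon> / (2 * real (matroid_rank \<I>))) (1 + \<epsilon>)"
  unfolding admits_improving_moves_def
proof (intro ballI impI, rule ccontr)
  interpret stochastic_base_problem S \<I> D by fact
  let ?r = "real (matroid_rank \<I>)"
  fix B
  assume B: "B \<in> bases \<I>" and gap: "(1 + \<epsilon>) * OPT (bases \<I>) (Cost D) < Cost D B"
    and none: "\<not> (\<exists>x'\<in>circuit_swaps S \<I> B. Cost D x' \<le> (1 - \<epsilon> / (2 * ?r)) * Cost D B)"
  define w where "w s = (\<integral>z. z s \<partial>D)" for s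
  \<comment> \<open>The improvement a swap of \<open>B\<close> would need; under
    \<open>none\<close>, every swap gains less.\<close>
  define \<delta> where "\<delta> = \<epsilon> / (2 * ?r) * Cost D B"
  have cost: "Cost D A = sum w A" if "A \<in> bases \<I>" for A
    using that Cost_eq_sum indep_subset_ground by (simp add: bases_def w_def)
  have w_nonneg: "0 \<le> w s" if "s \<in> S" for s
    unfolding w_def using cost_nonneg[OF that] by (rule integral_nonneg_AE)
  have cost_nonneg: "0 \<le> Cost D A" if "A \<in> bases \<I>" for A
    using that w_nonneg indep_subset_ground by (auto simp: cost bases_def intro!: sum_nonneg)
  have "OPT (bases \<I>) (Cost D) \<in> Cost D ` bases \<I>"
    unfolding OPT_def using finite_bases bases_nonempty by (intro Min_in) auto
  then obtain B' where B': "B' \<in> bases \<I>" "OPT (bases \<I>) (Cost D) = Cost D B'"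
    by auto
  have fin: "finite B"
    using B finite_indep by (auto simp: bases_def)
  have "w t - w y \<le> \<delta>"
    if t: "t \<in> B" and y: "y \<in> S - B" and swap: "insert y (B - {t}) \<in> bases \<I>" for t y
  proof -
    have "(1 - \<epsilon> / (2 * ?r)) * Cost D B < Cost D (insert y (B - {t}))"
      using none circuit_swapsI[OF B y t swap] by force
    also have "\<dots> = Cost D B - w t + w y"
      using cost[OF swap] cost[OF B] t y fin by (simp add: sum_diff1)
    finally show ?thesis
      by (simp add: \<delta>_def algebra_simps)
  qed
  then have "Cost D B - Cost D B' \<le> real (card (B - B')) * \<delta>"
    using base_weight_diff_le[OF B B'(1)] cost B B'(1) by simp
  also have "\<dots> \<le> ?r * \<delta>"
  proof (rule mult_right_mono)
    show "real (card (B - B')) \<le> ?r"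
      using card_mono[of B "B - B'"] fin card_base[OF B] by auto
    show "0 \<le> \<delta>"
      using cost_nonneg[OF B] assms by (simp add: \<delta>_def)
  qed
  also have "\<dots> = \<epsilon> / 2 * Cost D B"
    using assms(2) by (simp add: \<delta>_def)
  finally have "(1 - \<epsilon> / 2) * Cost D B \<le> Cost D B'"
    by (simp add: algebra_simps)
  then have "(1 + \<epsilon>) * ((1 - \<epsilon> / 2) * Cost D B) \<le> (1 + \<epsilon>) * Cost D B'"
    using assms(3) by (intro mult_left_mono) auto
  also have "\<dots> < Cost D B"
    using gap B'(2) by simp
  \<comment> \<open>Uses (1 + \<epsilon>) * (1 - \<epsilon> / 2) - 1 = \<epsilon> * (1 - \<epsilon>)
    / 2, which is nonnegative exactly because 0 < \<epsilon> \<le> 1.\<close>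
  finally have "\<epsilon> * (1 - \<epsilon>) * Cost D B < 0"
    by (simp add: field_simps)
  moreover have "0 \<le> \<epsilon> * (1 - \<epsilon>) * Cost D B"
    using assms cost_nonneg[OF B] by simp
  ultimately show False by simp
qed

end
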